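(* Assume that first-order Peano arithmetic $\mathsf{PA}$ is consistent. Then there is a countable model $M$ of $\mathsf{PA}$ containing an infinite sequence $q_1<q_2<\cdots<q_i<\cdots$ (indexed by $i=1,2,\dots$) of infinite primes of $M$ such that for each $i=1,2,\dots$, no finite prime of $M$ is a divisor of $q_i+2$ in $M$.
   Context: $\mathsf{PA}$ denotes first-order Peano arithmetic in the language $\mathcal L=\{+,\cdot,S,0\}$, where $S$ is the successor function symbol. The standard model of $\mathsf{PA}$ is $\langle\mathbb N,+,\cdot,S,0\rangle$ with $\mathbb N=\{0,1,2,\dots\}$ and the usual operations; any model of $\mathsf{PA}$ not isomorphic to it is called nonstandard. In a model of $\mathsf{PA}$, $x\le y$ abbreviates $\exists z\; x+z=y$, and $<,>,\ge$ are the derived relations; $2$ denotes the element $SS0$. A prime in a model $M$ of $\mathsf{PA}$ with universe $U$ is an element $q\in U$ with $q\ge 2$ such that for all $x,y\in U$, if $x\cdot y=q$ then $x=q$ or $y=q$. An element $a\in U$ is a divisor of $b\in U$ if $b=z\cdot a$ for some $z\in U$. Every nonstandard model $L$ of $\mathsf{PA}$ has an initial segment $N_L$ isomorphic to the standard model, consisting of the interpretations of the numerals $S\cdots S0$; the primes of $L$ lying in $N_L$ are called finite, and the primes of $L$ not lying in $N_L$ are called infinite (or nonstandard). *)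

theory Defs
  imports Main "HOL-Library.Countable_Set"
begin

text \<open>Variables are de Bruijn indices: under \<open>All\<close>, index 0 is the bound variable. The other
  connectives and the existential quantifier are the usual classical abbreviations.\<close>

datatype tm = Var nat | Zero | Succ tm | Add tm tm | Mul tm tm

datatype fm = Eq tm tm | Falsum | Imp fm fm | All fm

abbreviation Neg :: "fm \<Rightarrow> fm" where
  "Neg \<phi> \<equiv> Imp \<phi> Falsum"

primrec tsubst :: "(nat \<Rightarrow> tm) \<Rightarrow> tm \<Rightarrow> tm" where
  "tsubst \<sigma> (Var n) = \<sigma> n"
| "tsubst \<sigma> Zero = Zero"
| "tsubst \<sigma> (Succ t) = Succ (tsubst \<sigma> t)"
| "tsubst \<sigma> (Add s t) = Add (tsubst \<sigma> s) (tsubst \<sigma> t)"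
| "tsubst \<sigma> (Mul s t) = Mul (tsubst \<sigma> s) (tsubst \<sigma> t)"

primrec subst :: "(nat \<Rightarrow> tm) \<Rightarrow> fm \<Rightarrow> fm" where
  "subst \<sigma> (Eq s t) = Eq (tsubst \<sigma> s) (tsubst \<sigma> t)"
| "subst \<sigma> Falsum = Falsum"
| "subst \<sigma> (Imp \<phi> \<psi>) = Imp (subst \<sigma> \<phi>) (subst \<sigma> \<psi>)"
| "subst \<sigma> (All \<phi>) =
     All (subst (case_nat (Var 0) (\<lambda>n. tsubst (\<lambda>k. Var (Suc k)) (\<sigma> n))) \<phi>)"

text \<open>\<open>lift \<phi>\<close> is \<open>\<phi>\<close> placed under one more quantifier, not mentioning the new variable;
  \<open>inst \<phi> t\<close> replaces variable 0 by \<open>t\<close> and lowers the remaining indices.\<close>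

definition lift :: "fm \<Rightarrow> fm" where
  "lift \<phi> = subst (\<lambda>n. Var (Suc n)) \<phi>"

definition inst :: "fm \<Rightarrow> tm \<Rightarrow> fm" where
  "inst \<phi> t = subst (case_nat t Var) \<phi>"

primrec tm_vars :: "tm \<Rightarrow> nat set" where
  "tm_vars (Var n) = {n}"
| "tm_vars Zero = {}"
| "tm_vars (Succ t) = tm_vars t"
| "tm_vars (Add s t) = tm_vars s \<union> tm_vars t"
| "tm_vars (Mul s t) = tm_vars s \<union> tm_vars t"

primrec free_vars :: "fm \<Rightarrow> nat set" where
  "free_vars (Eq s t) = tm_vars s \<union> tm_vars t"
| "free_vars Falsum = {}"
| "free_vars (Imp \<phi> \<psi>) = free_vars \<phi> \<union> free_vars \<psi>"
| "free_vars (All \<phi>) = {n. Suc n \<in> free_vars \<phi>}"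

text \<open>Natural deduction for classical first-order logic with equality. The eigenvariable condition
  of \<open>\<forall>\<close>-introduction is expressed by lifting the hypotheses.\<close>

inductive derives :: "fm set \<Rightarrow> fm \<Rightarrow> bool" (infix "\<turnstile>" 50) where
  Assm: "\<phi> \<in> \<Gamma> \<Longrightarrow> \<Gamma> \<turnstile> \<phi>"
| ImpI: "insert \<phi> \<Gamma> \<turnstile> \<psi> \<Longrightarrow> \<Gamma> \<turnstile> Imp \<phi> \<psi>"
| ImpE: "\<Gamma> \<turnstile> Imp \<phi> \<psi> \<Longrightarrow> \<Gamma> \<turnstile> \<phi> \<Longrightarrow> \<Gamma> \<turnstile> \<psi>"
| Contr: "insert (Neg \<phi>) \<Gamma> \<turnstile> Falsum \<Longrightarrow> \<Gamma> \<turnstile> \<phi>"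
| AllI: "lift ` \<Gamma> \<turnstile> \<phi> \<Longrightarrow> \<Gamma> \<turnstile> All \<phi>"
| AllE: "\<Gamma> \<turnstile> All \<phi> \<Longrightarrow> \<Gamma> \<turnstile> inst \<phi> t"
| EqRefl: "\<Gamma> \<turnstile> Eq t t"
| EqSubst: "\<Gamma> \<turnstile> Eq s t \<Longrightarrow> \<Gamma> \<turnstile> inst \<phi> s \<Longrightarrow> \<Gamma> \<turnstile> inst \<phi> t"

definition consistent :: "fm set \<Rightarrow> bool" where
  "consistent \<Gamma> \<longleftrightarrow> \<not> \<Gamma> \<turnstile> Falsum"

text \<open>The induction formula for \<open>\<phi>\<close> in variable 0, the other variables being parameters:
  \<open>\<phi>(0) \<longrightarrow> (\<forall>x. \<phi>(x) \<longrightarrow> \<phi>(S x)) \<longrightarrow> (\<forall>x. \<phi>(x))\<close>.\<close>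

definition induction_fm :: "fm \<Rightarrow> fm" where
  "induction_fm \<phi> =
     Imp (inst \<phi> Zero)
       (Imp (All (Imp \<phi> (subst (case_nat (Succ (Var 0)) (\<lambda>n. Var (Suc n))) \<phi>)))
         (All \<phi>))"

text \<open>All axioms are sentences; the induction scheme consists of the universal closures of the
  induction formulas.\<close>

inductive_set PA :: "fm set" where
  succ_nonzero: "All (Neg (Eq (Succ (Var 0)) Zero)) \<in> PA"
| succ_inject:
    "All (All (Imp (Eq (Succ (Var 0)) (Succ (Var 1))) (Eq (Var 0) (Var 1)))) \<in> PA"
| add_zero: "All (Eq (Add (Var 0) Zero) (Var 0)) \<in> PA"
| add_succ:
    "All (All (Eq (Add (Var 0) (Succ (Var 1))) (Succ (Add (Var 0) (Var 1))))) \<in> PA"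
| mul_zero: "All (Eq (Mul (Var 0) Zero) Zero) \<in> PA"
| mul_succ:
    "All (All (Eq (Mul (Var 0) (Succ (Var 1))) (Add (Mul (Var 0) (Var 1)) (Var 0)))) \<in> PA"
| induction:
    "free_vars ((All ^^ n) (induction_fm \<phi>)) = {} \<Longrightarrow> (All ^^ n) (induction_fm \<phi>) \<in> PA"

record 'a arith =
  univ :: "'a set"
  zero_of :: 'a
  succ_of :: "'a \<Rightarrow> 'a"
  add_of :: "'a \<Rightarrow> 'a \<Rightarrow> 'a"
  mul_of :: "'a \<Rightarrow> 'a \<Rightarrow> 'a"

definition is_structure :: "'a arith \<Rightarrow> bool" where
  "is_structure M \<longleftrightarrow>
     zero_of M \<in> univ M \<and>
     (\<forall>x\<in>univ M. succ_of M x \<in> univ M) \<and>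
     (\<forall>x\<in>univ M. \<forall>y\<in>univ M. add_of M x y \<in> univ M \<and> mul_of M x y \<in> univ M)"

primrec tm_val :: "'a arith \<Rightarrow> (nat \<Rightarrow> 'a) \<Rightarrow> tm \<Rightarrow> 'a" where
  "tm_val M e (Var n) = e n"
| "tm_val M e Zero = zero_of M"
| "tm_val M e (Succ t) = succ_of M (tm_val M e t)"
| "tm_val M e (Add s t) = add_of M (tm_val M e s) (tm_val M e t)"
| "tm_val M e (Mul s t) = mul_of M (tm_val M e s) (tm_val M e t)"

primrec sat :: "'a arith \<Rightarrow> (nat \<Rightarrow> 'a) \<Rightarrow> fm \<Rightarrow> bool" where
  "sat M e (Eq s t) \<longleftrightarrow> tm_val M e s = tm_val M e t"
| "sat M e Falsum \<longleftrightarrow> False"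
| "sat M e (Imp \<phi> \<psi>) \<longleftrightarrow> (sat M e \<phi> \<longrightarrow> sat M e \<psi>)"
| "sat M e (All \<phi>) \<longleftrightarrow> (\<forall>x\<in>univ M. sat M (case_nat x e) \<phi>)"

definition is_model :: "'a arith \<Rightarrow> fm set \<Rightarrow> bool" where
  "is_model M \<Gamma> \<longleftrightarrow>
     is_structure M \<and> (\<forall>\<phi>\<in>\<Gamma>. \<forall>e. range e \<subseteq> univ M \<longrightarrow> sat M e \<phi>)"

definition le_in :: "'a arith \<Rightarrow> 'a \<Rightarrow> 'a \<Rightarrow> bool" where
  "le_in M x y \<longleftrightarrow> (\<exists>z\<in>univ M. add_of M x z = y)"

definition less_in :: "'a arith \<Rightarrow> 'a \<Rightarrow> 'a \<Rightarrow> bool" where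
  "less_in M x y \<longleftrightarrow> le_in M x y \<and> x \<noteq> y"

definition two_of :: "'a arith \<Rightarrow> 'a" where
  "two_of M = succ_of M (succ_of M (zero_of M))"

definition divisor_in :: "'a arith \<Rightarrow> 'a \<Rightarrow> 'a \<Rightarrow> bool" where
  "divisor_in M a b \<longleftrightarrow> (\<exists>z\<in>univ M. b = mul_of M z a)"

definition prime_in :: "'a arith \<Rightarrow> 'a \<Rightarrow> bool" where
  "prime_in M q \<longleftrightarrow>
     q \<in> univ M \<and> le_in M (two_of M) q \<and>
     (\<forall>x\<in>univ M. \<forall>y\<in>univ M. mul_of M x y = q \<longrightarrow> x = q \<or> y = q)"

text \<open>The initial segment of standard elements, i.e. the values of the numerals \<open>S \<dots> S 0\<close>.\<close>

definition standard_part :: "'a arith \<Rightarrow> 'a set" where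
  "standard_part M = range (\<lambda>n. (succ_of M ^^ n) (zero_of M))"

definition finite_prime :: "'a arith \<Rightarrow> 'a \<Rightarrow> bool" where
  "finite_prime M q \<longleftrightarrow> prime_in M q \<and> q \<in> standard_part M"

definition infinite_prime :: "'a arith \<Rightarrow> 'a \<Rightarrow> bool" where
  "infinite_prime M q \<longleftrightarrow> prime_in M q \<and> q \<notin> standard_part M"

end

theory Submission
  imports Defs Complex_Main "HOL-Number_Theory.Number_Theory"
begin

text \<open>The model is an ultrapower of the standard model, thinned out so as to be countable, and the
  \<open>q\<^sub>i\<close> are classes of sequences of ordinary primes. In the standard model there are, for each
  \<open>n\<close>, arbitrarily large primes \<open>q\<close> with \<open>n! dvd q + 1\<close>; then \<open>q + 2\<close> is \<open>1\<close> modulo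
  every number from \<open>2\<close> to \<open>n\<close>. Choose such primes \<open>g 0 n < g 1 n < \<dots>\<close>, all above \<open>n\<close>, and
  let \<open>q\<^sub>i\<close> be the class of the sequence \<open>n \<mapsto> g i n\<close> modulo a nonprincipal ultrafilter. By the
  theorem of Los, \<open>q\<^sub>i\<close> is prime and \<open>q\<^sub>i < q\<^bsub>i+1\<^esub>\<close>; it is infinite because \<open>g i n > n\<close>, and a
  finite prime \<open>k\<close> cannot divide \<open>q\<^sub>i + 2\<close> because \<open>k dvd g i n + 2\<close> fails for all \<open>n \<ge> k\<close>.

  Countability: instead of all sequences of natural numbers only those are used that are values of
  Skolem terms built from the \<open>g i\<close>. They contain witnesses for every existential statement about
  their members, which is all that the proof of the theorem of Los (\<open>los\<close>) asks for.

  Primes congruent to \<open>-1\<close> modulo \<open>n\<close> (\<open>prime_cong_minus_1\<close>) are found without Dirichlet's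
  theorem, among the prime divisors of a Lucas number \<open>U m\<close>, where \<open>m\<close> is a multiple of \<open>n\<close> and
  \<open>U k\<close>, here and below, stands for \<open>lucas P Q k\<close>: \<open>U 0 = 0\<close>, \<open>U 1 = 1\<close> and
  \<open>U (k + 2) = P * U (k + 1) - Q * U k\<close>. A prime \<open>q\<close> for which
  \<open>m\<close> is the least positive index with \<open>q dvd U m\<close> (its rank), and which is odd and divides neither
  \<open>m\<close> nor \<open>Q\<close>, satisfies \<open>q \<equiv> 1\<close> or \<open>q \<equiv> -1\<close>
  modulo \<open>m\<close>, the Lucas analogue of the fact that the multiplicative order divides \<open>q - 1\<close>. To exclude
  that all of them are \<open>\<equiv> 1\<close>, choose \<open>P \<equiv> 1\<close> and \<open>Q \<equiv> 0\<close> modulo \<open>m\<close>, so that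
  \<open>U k \<equiv> 1\<close> for all \<open>k > 0\<close>, and such that the roots of \<open>x\<^sup>2 - P x + Q\<close> are \<open>c exp (\<plusminus> \<i> t)\<close> with
  \<open>t\<close> between \<open>\<pi> / m\<close> and \<open>2 \<pi> / m\<close>. As \<open>U k\<close> has the sign of \<open>sin (k t)\<close>, \<open>U m\<close> is negative
  while \<open>U d\<close> is positive for the proper divisors \<open>d\<close> of \<open>m\<close>. Hence \<open>\<bar>U m\<bar> \<equiv> -1\<close> but
  \<open>\<bar>U d\<bar> \<equiv> 1\<close>. The second fact makes the part of \<open>U m\<close> that comes from primes of rank below \<open>m\<close>
  congruent to \<open>1\<close>, so the part that comes from primes of rank \<open>m\<close> is congruent to \<open>-1\<close>, and not all
  of these primes can be \<open>\<equiv> 1\<close>.\<close>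

section \<open>Lucas sequences\<close>

fun lucas :: "int \<Rightarrow> int \<Rightarrow> nat \<Rightarrow> int" where
  "lucas P Q 0 = 0"
| "lucas P Q (Suc 0) = 1"
| "lucas P Q (Suc (Suc n)) = P * lucas P Q (Suc n) - Q * lucas P Q n"

lemma lucas_add:
  "lucas P Q (Suc (m + n)) = lucas P Q (Suc m) * lucas P Q (Suc n) - Q * lucas P Q m * lucas P Q n"
proof (induction m rule: less_induct)
  case (less m)
  consider "m = 0" | "m = 1" | k where "m = Suc (Suc k)"
    by (metis One_nat_def not0_implies_Suc)
  then show ?case
  proof cases
    case 3
    have "lucas P Q (Suc (m + n)) = P * lucas P Q (Suc (Suc k + n)) - Q * lucas P Q (Suc (k + n))"
      using 3 by simp
    also have "\<dots> = P * (lucas P Q (Suc (Suc k)) * lucas P Q (Suc n) - Q * lucas P Q (Suc k) * lucas P Q n)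
        - Q * (lucas P Q (Suc k) * lucas P Q (Suc n) - Q * lucas P Q k * lucas P Q n)"
      using 3 by (simp only: less.IH[of k] less.IH[of "Suc k"])
    also have "\<dots> = lucas P Q (Suc m) * lucas P Q (Suc n) - Q * lucas P Q m * lucas P Q n"
      using 3 by (simp add: algebra_simps)
    finally show ?thesis .
  qed auto
qed

text \<open>The analogue of Cassini's identity for Fibonacci numbers. It shows that neighbouring terms share no
  prime factor off \<open>Q\<close>, and it ties \<open>U (q - 1)\<close> and \<open>U (q + 1)\<close> to \<open>U q\<close>.\<close>

lemma lucas_cassini:
  "lucas P Q (Suc n) ^ 2 - lucas P Q n * lucas P Q (Suc (Suc n)) = Q ^ n"
proof (induction n)
  case (Suc n)
  have "lucas P Q (Suc (Suc n)) ^ 2 - lucas P Q (Suc n) * lucas P Q (Suc (Suc (Suc n)))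
      = Q * (lucas P Q (Suc n) ^ 2 - lucas P Q n * lucas P Q (Suc (Suc n)))"
    by (simp add: algebra_simps power2_eq_square)
  then show ?case using Suc by simp
qed simp

lemma lucas_cong_1:
  assumes "[P = 1] (mod m)" "m dvd Q"
  shows "[lucas P Q (Suc n) = 1] (mod m)"
proof (induction n)
  case (Suc n)
  have "[P * lucas P Q (Suc n) - Q * lucas P Q n = 1 * 1 - 0] (mod m)"
    using assms Suc by (intro cong_diff cong_mult) (auto simp: cong_0_iff)
  then show ?case by simp
qed simp

text \<open>If the roots of \<open>x\<^sup>2 - P x + c\<^sup>2\<close> are \<open>c exp (\<plusminus> \<i> t)\<close>, Binet's formula becomes
  \<open>U k = c ^ (k - 1) sin (k t) / sin t\<close>: the signs of the Lucas numbers are those of a sine.\<close>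

lemma lucas_sine:
  assumes "real_of_int P = 2 * of_int c * cos t"
  shows "sin t * of_int (lucas P (c^2) (Suc n)) = of_int c ^ n * sin (real (Suc n) * t)"
proof (induction n rule: less_induct)
  case (less n)
  consider "n = 0" | "n = 1" | k where "n = Suc (Suc k)"
    by (metis One_nat_def not0_implies_Suc)
  then show ?case
  proof cases
    case 2
    then show ?thesis using assms sin_double[of t] by (simp add: algebra_simps)
  next
    case (3 k)
    define x where "x = real (Suc (Suc k)) * t"
    have e: "real (Suc n) * t = x + t" "real (Suc k) * t = x - t"
      using 3 by (simp_all add: x_def algebra_simps)
    have "sin t * of_int (lucas P (c^2) (Suc n))
        = of_int P * (sin t * of_int (lucas P (c^2) (Suc (Suc k))))
          - of_int c ^ 2 * (sin t * of_int (lucas P (c^2) (Suc k)))"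
      using 3 by (simp add: algebra_simps)
    also have "\<dots> = of_int P * (of_int c ^ Suc k * sin x) - of_int c ^ 2 * (of_int c ^ k * sin (x - t))"
      using less.IH[of k] less.IH[of "Suc k"] 3 e(2) by (simp add: x_def)
    also have "\<dots> = of_int c ^ n * (2 * cos t * sin x - sin (x - t))"
      using 3 assms by (simp add: algebra_simps power2_eq_square)
    also have "2 * cos t * sin x - sin (x - t) = sin (x + t)"
      by (simp add: sin_add sin_diff)
    finally show ?thesis using e by simp
  qed simp
qed

lemma prime_not_dvd_consecutive_lucas:
  assumes "prime q" "\<not> q dvd Q" "q dvd lucas P Q n"
  shows "\<not> q dvd lucas P Q (Suc n)"
proof
  assume "q dvd lucas P Q (Suc n)"
  then have "q dvd lucas P Q (Suc n) ^ 2 - lucas P Q n * lucas P Q (Suc (Suc n))"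
    using assms(3) by (simp add: power2_eq_square)
  then have "q dvd Q ^ n" by (simp only: lucas_cassini)
  then show False using assms prime_dvd_power by blast
qed

definition lucas_rank :: "int \<Rightarrow> int \<Rightarrow> int \<Rightarrow> nat" where
  "lucas_rank P Q q = (LEAST d. 0 < d \<and> q dvd lucas P Q d)"

context
  fixes P Q q :: int and m :: nat
  assumes q: "prime q" "\<not> q dvd Q" and m: "0 < m" "q dvd lucas P Q m"
begin

lemma lucas_rank_props:
  shows lucas_rank_pos: "0 < lucas_rank P Q q"
    and dvd_lucas_rank: "q dvd lucas P Q (lucas_rank P Q q)"
    and lucas_rank_le: "\<And>d. 0 < d \<Longrightarrow> q dvd lucas P Q d \<Longrightarrow> lucas_rank P Q q \<le> d"
  using LeastI[of "\<lambda>d. 0 < d \<and> q dvd lucas P Q d" m] m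
    Least_le[of "\<lambda>d. 0 < d \<and> q dvd lucas P Q d"]
  unfolding lucas_rank_def by auto

lemma lucas_rank_neq_1: "lucas_rank P Q q \<noteq> 1"
  using dvd_lucas_rank q(1) by (auto dest: not_prime_unit)

text \<open>With \<open>d\<close> the rank, the addition formula gives \<open>U (d + k) \<equiv> - Q * U (d - 1) * U k\<close> modulo \<open>q\<close> with
  an invertible factor, so divisibility by \<open>q\<close> is periodic in the index with period \<open>d\<close>.\<close>

lemma dvd_lucas_iff_rank_dvd: "q dvd lucas P Q n \<longleftrightarrow> lucas_rank P Q q dvd n"
proof (induction n rule: less_induct)
  case (less n)
  define d where "d = lucas_rank P Q q"
  have d: "0 < d" "q dvd lucas P Q d"
    using lucas_rank_pos dvd_lucas_rank by (simp_all add: d_def)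
  show ?case
  proof (cases "n < d")
    case True
    then show ?thesis
      using lucas_rank_le[of n] by (cases "n = 0") (auto simp: d_def dest: dvd_imp_le)
  next
    case False
    then obtain k where k: "n = d + k" by (metis le_add_diff_inverse not_less)
    obtain b where b: "d = Suc b" using d(1) by (cases d) auto
    have "\<not> q dvd lucas P Q b"
      using prime_not_dvd_consecutive_lucas[OF q, of P b] d(2) b by auto
    then have "\<not> q dvd Q * lucas P Q b" using q by (simp add: prime_dvd_mult_iff)
    moreover have "lucas P Q n = lucas P Q d * lucas P Q (Suc k) - Q * lucas P Q b * lucas P Q k"
      using lucas_add[of P Q b k] by (simp add: k b)
    ultimately have "q dvd lucas P Q n \<longleftrightarrow> q dvd lucas P Q k"
      using q d(2) by (simp add: dvd_diff_right_iff prime_dvd_mult_iff)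
    also have "\<dots> \<longleftrightarrow> d dvd k"
      using less.IH[of k] k d(1) by (simp add: d_def)
    finally show ?thesis by (simp add: k d_def)
  qed
qed

end

text \<open>Put \<open>d = Suc b\<close>. Modulo \<open>U d\<close> one step in the index multiplies by \<open>w = - Q * U b\<close>, so the cofactor of
  \<open>U d\<close> in \<open>U (d * k)\<close> is \<open>k * w ^ (k - 1)\<close>, as for \<open>(x ^ k - y ^ k) / (x - y)\<close> when \<open>x \<equiv> y\<close>. The
  congruence for the neighbouring term is carried along for the induction.\<close>

lemma lucas_mult_cofactor:
  "\<exists>X. lucas P Q (Suc b * k) = lucas P Q (Suc b) * X \<and>
     [X = int k * (- Q * lucas P Q b) ^ (k - 1)] (mod lucas P Q (Suc b)) \<and>
     [lucas P Q (Suc (Suc b * k)) = (- Q * lucas P Q b) ^ k] (mod lucas P Q (Suc b))"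
proof (induction k)
  case 0
  show ?case by (intro exI[of _ 0]) simp
next
  case (Suc k)
  define D w where "D = lucas P Q (Suc b)" and "w = - Q * lucas P Q b"
  obtain X where X: "lucas P Q (Suc b * k) = D * X" "[X = int k * w ^ (k - 1)] (mod D)"
      "[lucas P Q (Suc (Suc b * k)) = w ^ k] (mod D)"
    using Suc by (auto simp: D_def w_def)
  have "lucas P Q (Suc b * Suc k) = lucas P Q (Suc (b + Suc b * k))" by simp
  also have "\<dots> = D * (lucas P Q (Suc (Suc b * k)) + w * X)"
    unfolding lucas_add X(1) by (simp add: D_def w_def algebra_simps)
  finally have 1: "lucas P Q (Suc b * Suc k) = D * (lucas P Q (Suc (Suc b * k)) + w * X)" .
  have "[lucas P Q (Suc (Suc b * k)) + w * X = w ^ k + w * (int k * w ^ (k - 1))] (mod D)"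
    by (intro cong_add cong_mult X cong_refl)
  also have "w ^ k + w * (int k * w ^ (k - 1)) = int (Suc k) * w ^ (Suc k - 1)"
    by (cases k) (simp_all add: algebra_simps)
  finally have 2: "[lucas P Q (Suc (Suc b * k)) + w * X = int (Suc k) * w ^ (Suc k - 1)] (mod D)" .
  have "lucas P Q (Suc (Suc b * Suc k)) = lucas P Q (Suc (Suc b + Suc b * k))"
    by simp
  also have "\<dots> = lucas P Q (Suc (Suc b)) * lucas P Q (Suc (Suc b * k)) - Q * D * lucas P Q (Suc b * k)"
    unfolding lucas_add by (simp add: D_def)
  also have "\<dots> = w * lucas P Q (Suc (Suc b * k)) +
      D * (P * lucas P Q (Suc (Suc b * k)) - Q * lucas P Q (Suc b * k))"
    by (simp add: D_def w_def algebra_simps)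
  also have "[\<dots> = w * w ^ k + 0] (mod D)"
    by (intro cong_add cong_mult X cong_refl) (simp add: cong_0_iff)
  finally have 3: "[lucas P Q (Suc (Suc b * Suc k)) = w ^ Suc k] (mod D)" by simp
  show ?case using 1 2 3 unfolding D_def w_def by blast
qed

text \<open>The easy half of lifting the exponent: the cofactor is prime to \<open>q\<close> as long as \<open>q\<close> does not divide \<open>k\<close>.\<close>

lemma multiplicity_lucas_mult:
  assumes q: "prime q" "\<not> q dvd Q" and d: "0 < d" "q dvd lucas P Q d" and k: "\<not> q dvd int k"
  shows "multiplicity q (lucas P Q (d * k)) = multiplicity q (lucas P Q d)"
proof -
  obtain b where b: "d = Suc b" using d(1) by (cases d) auto
  define w where "w = - Q * lucas P Q b"
  obtain X where X: "lucas P Q (d * k) = lucas P Q d * X"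
      "[X = int k * w ^ (k - 1)] (mod lucas P Q d)"
    using lucas_mult_cofactor[of P Q b k] by (auto simp: b w_def)
  have "\<not> q dvd lucas P Q b"
    using prime_not_dvd_consecutive_lucas[OF q, of P b] d(2) b by auto
  then have "\<not> q dvd w" using q by (simp add: prime_dvd_mult_iff w_def)
  then have "\<not> q dvd int k * w ^ (k - 1)"
    using q k by (metis prime_dvd_mult_iff prime_dvd_power)
  moreover have "[X = int k * w ^ (k - 1)] (mod q)"
    using X(2) d(2) cong_dvd_modulus by blast
  ultimately have "\<not> q dvd X" using cong_dvd_iff by blast
  then have "X \<noteq> 0" "multiplicity q X = 0" by (auto simp: not_dvd_imp_multiplicity_0)
  then show ?thesis
    using q(1) X(1) by (cases "lucas P Q d = 0") (auto simp: prime_elem_multiplicity_mult_distrib)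
qed

lemma lucas_binet:
  fixes s :: complex
  assumes "s ^ 2 = of_int (P ^ 2 - 4 * Q)"
  shows "(of_int P + s) ^ n - (of_int P - s) ^ n = 2 ^ n * s * of_int (lucas P Q n)"
proof (induction n rule: less_induct)
  case (less n)
  consider "n = 0" | "n = 1" | k where "n = Suc (Suc k)"
    by (metis One_nat_def not0_implies_Suc)
  then show ?case
  proof cases
    case (3 k)
    define a b where "a = of_int P + s" and "b = of_int P - s"
    have ab: "a + b = 2 * of_int P" "a * b = 4 * of_int Q"
      using assms by (simp_all add: a_def b_def algebra_simps power2_eq_square)
    have "a ^ n - b ^ n = (a + b) * (a ^ Suc k - b ^ Suc k) - (a * b) * (a ^ k - b ^ k)"
      using 3 by (simp add: algebra_simps)
    also have "\<dots> = 2 ^ n * s * of_int (lucas P Q n)"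
      using less.IH[of k] less.IH[of "Suc k"] 3
      unfolding ab by (simp add: a_def b_def algebra_simps)
    finally show ?thesis by (simp add: a_def b_def)
  qed simp_all
qed

lemma fermat_theorem_int:
  assumes "prime q" "\<not> int q dvd x"
  shows "[x ^ (q - 1) = 1] (mod int q)"
proof -
  define y where "y = nat (x mod int q)"
  have y: "[x = int y] (mod int q)" using prime_gt_0_nat[OF assms(1)] by (simp add: y_def cong_def)
  then have "\<not> int q dvd int y" using assms(2) cong_dvd_iff by blast
  then have "[y ^ (q - 1) = 1] (mod q)" using fermat_theorem[OF assms(1)] by simp
  then have "[int y ^ (q - 1) = 1] (mod int q)"
    using cong_int_iff[of "y ^ (q - 1)" 1 q] by simp
  then show ?thesis using y cong_pow cong_trans by blast
qed

text \<open>Expanding both powers in Binet's formula, every binomial coefficient except the outermost ones is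
  divisible by \<open>q\<close>, and the even powers of \<open>s\<close> cancel; what survives is \<open>s ^ q\<close>.\<close>

lemma lucas_prime_index:
  assumes q: "prime q" "odd q" and D: "P ^ 2 - 4 * Q \<noteq> 0"
  shows "[lucas P Q q = (P ^ 2 - 4 * Q) ^ ((q - 1) div 2)] (mod int q)"
proof -
  define D where "D = P ^ 2 - 4 * Q"
  define s where "s = csqrt (of_int D)"
  have s: "s ^ 2 = of_int D" by (simp add: s_def)
  moreover have "(of_int D :: complex) \<noteq> 0" using D by (simp only: D_def of_int_eq_0_iff not_False_eq_True)
  ultimately have s0: "s \<noteq> 0" by auto
  define f where "f j = int (q choose j) * P ^ (q - j) * (if odd j then D ^ ((j - 1) div 2) else 0)" for j
  have pw: "s ^ j - (- s) ^ j = 2 * s * of_int (if odd j then D ^ ((j - 1) div 2) else 0)" for j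
  proof (cases "odd j")
    case True
    then obtain i where "j = Suc (2 * i)" by (metis oddE Suc_eq_plus1)
    then show ?thesis using s by (simp add: power_mult)
  qed simp
  have "(of_int P + s) ^ q - (of_int P - s) ^ q
      = (\<Sum>j\<le>q. of_nat (q choose j) * s ^ j * of_int P ^ (q - j))
        - (\<Sum>j\<le>q. of_nat (q choose j) * (- s) ^ j * of_int P ^ (q - j))"
    using binomial_ring[of s "of_int P" q] binomial_ring[of "- s" "of_int P" q]
    by (simp add: add.commute)
  also have "\<dots> = (\<Sum>j\<le>q. of_nat (q choose j) * of_int P ^ (q - j) * (s ^ j - (- s) ^ j))"
    by (simp add: sum_subtractf algebra_simps)
  also have "\<dots> = 2 * s * of_int (\<Sum>j\<le>q. f j)"
    unfolding pw by (simp add: f_def sum_distrib_left algebra_simps)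
  finally have "2 ^ q * s * of_int (lucas P Q q) = 2 * s * of_int (\<Sum>j\<le>q. f j)"
    using lucas_binet[of s P Q q] s by (simp add: D_def)
  then have "of_int (2 ^ q * lucas P Q q) = (of_int (2 * (\<Sum>j\<le>q. f j)) :: complex)"
    using s0 by simp
  then have "2 ^ q * lucas P Q q = 2 * (\<Sum>j\<le>q. f j)"
    by (simp only: of_int_eq_iff)
  moreover have "(2::int) ^ q = 2 * 2 ^ (q - 1)"
    using prime_gt_0_nat[OF q(1)] by (cases q) auto
  ultimately have eq: "2 ^ (q - 1) * lucas P Q q = (\<Sum>j\<le>q. f j)" by simp
  have "[f j = 0] (mod int q)" if "j < q" for j
  proof (cases "j = 0")
    case False
    then have "int q dvd int (q choose j)"
      using that q(1) dvd_choose_prime[of j q] by simp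
    then show ?thesis by (simp add: f_def cong_0_iff)
  qed (simp add: f_def)
  then have "[(\<Sum>j<q. f j) = (\<Sum>j<q. 0)] (mod int q)" by (intro cong_sum) auto
  then have "[(\<Sum>j<q. f j) + f q = 0 + f q] (mod int q)" by (intro cong_add) auto
  moreover have "(\<Sum>j\<le>q. f j) = (\<Sum>j<q. f j) + f q"
    by (metis lessThan_Suc_atMost sum.lessThan_Suc)
  ultimately have 1: "[2 ^ (q - 1) * lucas P Q q = f q] (mod int q)"
    by (simp only: eq add_0)
  have "\<not> int q dvd 2"
    using q by (metis even_numeral int_dvd_int_iff of_nat_numeral primes_dvd_imp_eq two_is_prime_nat)
  then have "[2 ^ (q - 1) = (1::int)] (mod int q)" by (rule fermat_theorem_int[OF q(1)])
  then have "[2 ^ (q - 1) * lucas P Q q = 1 * lucas P Q q] (mod int q)"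
    by (intro cong_mult cong_refl)
  then show ?thesis
    using 1 q(2) by (simp add: f_def D_def) (meson cong_sym cong_trans)
qed

text \<open>By Cassini's identity \<open>U (q - 1) * U (q + 1) = (U q)\<^sup>2 - Q ^ (q - 1)\<close>, where \<open>Q ^ (q - 1) \<equiv> 1\<close>. If \<open>q\<close> does
  not divide the discriminant, also \<open>(U q)\<^sup>2 \<equiv> 1\<close>, so \<open>q\<close> divides one of the two factors; otherwise
  \<open>q\<close> divides \<open>U q\<close> itself.\<close>

lemma lucas_rank_divides:
  assumes q: "prime q" "odd q" "\<not> int q dvd Q" and m: "0 < m" "int q dvd lucas P Q m"
    and D: "P ^ 2 - 4 * Q \<noteq> 0"
  defines "d \<equiv> lucas_rank P Q (int q)"
  shows "d = q \<or> d dvd q - 1 \<or> d dvd q + 1"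
proof -
  have q': "prime (int q)" using q by simp
  note iff = dvd_lucas_iff_rank_dvd[OF q' q(3) m, folded d_def]
  obtain b where b: "q = Suc b" using prime_gt_0_nat[OF q(1)] by (cases q) auto
  have Uq: "[lucas P Q q = (P ^ 2 - 4 * Q) ^ ((q - 1) div 2)] (mod int q)"
    by (rule lucas_prime_index) fact+
  have h: "0 < (q - 1) div 2" using q prime_gt_1_nat[OF q(1)] by (auto elim!: oddE)
  show ?thesis
  proof (cases "int q dvd P ^ 2 - 4 * Q")
    case True
    then have "int q dvd (P ^ 2 - 4 * Q) ^ ((q - 1) div 2)"
      using h by (metis dvd_power dvd_trans)
    then have "d dvd q" using Uq cong_dvd_iff iff by blast
    then have "d = q"
      using q(1) lucas_rank_neq_1[OF q' q(3) m] by (auto simp: prime_nat_iff d_def)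
    then show ?thesis ..
  next
    case False
    have "[lucas P Q q ^ 2 - Q ^ b = ((P ^ 2 - 4 * Q) ^ ((q - 1) div 2)) ^ 2 - 1] (mod int q)"
      using fermat_theorem_int[OF q(1) q(3)] by (intro cong_diff cong_pow Uq) (simp add: b)
    also have "((P ^ 2 - 4 * Q) ^ ((q - 1) div 2)) ^ 2 = (P ^ 2 - 4 * Q) ^ (q - 1)"
      using q(2) by (simp flip: power_mult)
    also have "[(P ^ 2 - 4 * Q) ^ (q - 1) - 1 = 1 - 1] (mod int q)"
      using fermat_theorem_int[OF q(1) False] by (intro cong_diff cong_refl)
    finally have "int q dvd lucas P Q q ^ 2 - Q ^ b" by (simp add: cong_0_iff)
    also have "lucas P Q q ^ 2 - Q ^ b = lucas P Q b * lucas P Q (Suc q)"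
      using lucas_cassini[of P Q b] by (simp add: b)
    finally have "int q dvd lucas P Q b \<or> int q dvd lucas P Q (Suc q)"
      using q' prime_dvd_mult_iff by blast
    then show ?thesis unfolding iff by (simp add: b)
  qed
qed

lemma multiplicity_nat_abs: "multiplicity q (nat \<bar>x\<bar>) = multiplicity (int q) x"
proof -
  have "q ^ n dvd nat \<bar>x\<bar> \<longleftrightarrow> int q ^ n dvd x" for n
    by (simp add: dvd_nat_abs_iff)
  then show ?thesis by (simp add: multiplicity_def)
qed

text \<open>A prime dividing \<open>U e\<close> occurs in \<open>U e\<close> and in \<open>U m\<close> with the same exponent, because it does
  not divide \<open>m\<close>. So all \<open>U e\<close> with \<open>e dvd m\<close> are made of the prime powers of the single number
  \<open>U m\<close>, sorted by rank.\<close>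

lemma lucas_eq_prod_by_rank:
  assumes m: "0 < m" and nz: "lucas P Q m \<noteq> 0" and e: "e dvd m"
    and good: "\<And>q. prime q \<Longrightarrow> int q dvd lucas P Q m \<Longrightarrow> \<not> q dvd m \<and> \<not> int q dvd Q"
  defines "S \<equiv> prime_factors (nat \<bar>lucas P Q m\<bar>)"
  shows "nat \<bar>lucas P Q e\<bar> = (\<Prod>q | q \<in> S \<and> lucas_rank P Q (int q) dvd e.
           q ^ multiplicity q (nat \<bar>lucas P Q m\<bar>))"
proof -
  obtain k where k: "m = e * k" using e by (elim dvdE)
  have e0: "0 < e" using e m by (cases e) auto
  have S: "prime q" "int q dvd lucas P Q m" "\<not> q dvd m" "\<not> int q dvd Q" if "q \<in> S" for q
  proof -
    show "prime q" "int q dvd lucas P Q m"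
      using that by (auto simp: S_def prime_factors_dvd dvd_nat_abs_iff)
    then show "\<not> q dvd m" "\<not> int q dvd Q" using good by blast+
  qed
  have iff: "int q dvd lucas P Q e \<longleftrightarrow> lucas_rank P Q (int q) dvd e" if "q \<in> S" for q
    using S[OF that] m by (intro dvd_lucas_iff_rank_dvd[of _ _ m]) auto
  have dvd: "lucas P Q e dvd lucas P Q m"
    using lucas_mult_cofactor[of P Q "e - 1" k] e0 k by auto
  then have Ue: "lucas P Q e \<noteq> 0" using nz by auto
  from dvd have "nat \<bar>lucas P Q e\<bar> dvd nat \<bar>lucas P Q m\<bar>" by (simp add: nat_abs_dvd_iff)
  then have "prime_factors (nat \<bar>lucas P Q e\<bar>) \<subseteq> S"
    unfolding S_def using nz by (intro dvd_prime_factors) auto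
  then have pf: "prime_factors (nat \<bar>lucas P Q e\<bar>) = {q \<in> S. lucas_rank P Q (int q) dvd e}"
    using iff Ue S(1) by (auto simp: prime_factors_dvd dvd_nat_abs_iff)
  have mult: "multiplicity q (nat \<bar>lucas P Q e\<bar>) = multiplicity q (nat \<bar>lucas P Q m\<bar>)"
    if q: "q \<in> S" "lucas_rank P Q (int q) dvd e" for q
  proof -
    have "\<not> int q dvd int k" using S(3)[OF q(1)] k by auto
    then have "multiplicity (int q) (lucas P Q m) = multiplicity (int q) (lucas P Q e)"
      unfolding k using S[OF q(1)] e0 iff[OF q(1)] q(2) by (intro multiplicity_lucas_mult) auto
    then show ?thesis by (simp add: multiplicity_nat_abs)
  qed
  have "nat \<bar>lucas P Q e\<bar> = (\<Prod>q\<in>prime_factors (nat \<bar>lucas P Q e\<bar>). q ^ multiplicity q (nat \<bar>lucas P Q e\<bar>))"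
    using Ue by (intro prime_factorization_nat) simp
  also have "\<dots> = (\<Prod>q | q \<in> S \<and> lucas_rank P Q (int q) dvd e. q ^ multiplicity q (nat \<bar>lucas P Q m\<bar>))"
    using mult by (intro prod.cong) (auto simp: pf)
  finally show ?thesis .
qed

section \<open>Primes congruent to -1\<close>

text \<open>Moebius inversion in disguise: let \<open>A d\<close> be the product over the ranks dividing \<open>d\<close> and
  \<open>R d\<close> the part of rank exactly \<open>d\<close>. If \<open>A d \<equiv> 1\<close> for all proper divisors of \<open>m\<close>, then
  \<open>R d \<equiv> 1\<close> for all of them, and \<open>A m \<equiv> R m\<close>.\<close>

lemma factor_of_top_rank:
  fixes \<rho> w :: "'a \<Rightarrow> nat"
  assumes S: "finite S" and m: "0 < m"
    and proper: "\<And>d. d dvd m \<Longrightarrow> d < m \<Longrightarrow> [(\<Prod>q | q \<in> S \<and> \<rho> q dvd d. w q) = 1] (mod m)"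
    and top: "\<not> [(\<Prod>q | q \<in> S \<and> \<rho> q dvd m. w q) = 1] (mod m)"
  shows "\<exists>q\<in>S. \<rho> q = m \<and> \<not> [w q = 1] (mod m)"
proof -
  define A where "A d = (\<Prod>q | q \<in> S \<and> \<rho> q dvd d. w q)" for d
  note proper = proper[folded A_def] and top = top[folded A_def]
  define R where "R d = (\<Prod>q | q \<in> S \<and> \<rho> q = d. w q)" for d
  have split: "A e = R e * (\<Prod>d | d dvd e \<and> d < e. R d)" if "e dvd m" for e
  proof -
    have e0: "0 < e" using that m by (cases e) auto
    then have "{d. d dvd e} = insert e {d. d dvd e \<and> d < e}"
      using dvd_imp_le[of _ e] by (auto simp: le_less)
    moreover have "A e = (\<Prod>d | d dvd e. \<Prod>q | q \<in> {q \<in> S. \<rho> q dvd e} \<and> \<rho> q = d. w q)"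
      unfolding A_def using e0 S by (intro prod.group[symmetric]) auto
    moreover have "\<dots> = (\<Prod>d | d dvd e. R d)"
      unfolding R_def by (intro prod.cong) auto
    ultimately show ?thesis by simp
  qed
  have below: "[A e = R e] (mod m)"
    if "e dvd m" "\<And>d. d dvd e \<Longrightarrow> d < e \<Longrightarrow> [R d = 1] (mod m)" for e
  proof -
    have "[(\<Prod>d | d dvd e \<and> d < e. R d) = (\<Prod>d | d dvd e \<and> d < e. 1)] (mod m)"
      using that by (intro cong_prod) auto
    then have "[R e * (\<Prod>d | d dvd e \<and> d < e. R d) = R e * 1] (mod m)"
      by (intro cong_mult) auto
    then show ?thesis using split[OF that(1)] by simp
  qed
  have R1: "[R d = 1] (mod m)" if "d dvd m" "d < m" for d
    using that
  proof (induction d rule: less_induct)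
    case (less d)
    have "[A d = R d] (mod m)"
      using less by (intro below less.IH) (auto intro: dvd_trans)
    then show ?case using proper[OF less.prems] cong_sym cong_trans by blast
  qed
  have "[A m = R m] (mod m)" using R1 by (intro below) auto
  then have "\<not> [R m = 1] (mod m)" using top cong_trans by blast
  moreover have "[R m = 1] (mod m)" if "\<forall>q\<in>S. \<rho> q = m \<longrightarrow> [w q = 1] (mod m)"
  proof -
    have "[R m = (\<Prod>q | q \<in> S \<and> \<rho> q = m. 1)] (mod m)"
      unfolding R_def using that by (intro cong_prod) auto
    then show ?thesis by simp
  qed
  ultimately show ?thesis by blast
qed

text \<open>The numbers \<open>(1 + m * k) / (2 * m ^ Suc r)\<close> with integral \<open>k\<close> have spacing \<open>1 / (2 * m ^ r)\<close>, so for large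
  \<open>r\<close> one of them lies between \<open>cos (2 * pi / m)\<close> and \<open>cos (pi / m)\<close>. Taking \<open>c\<close> to be a power of \<open>m\<close>
  ensures that \<open>P\<close> and \<open>c\<close> have no common prime factor.\<close>

lemma lucas_parameters:
  assumes "3 \<le> (m::nat)"
  obtains P c :: int and r and t :: real where "c = int m ^ Suc r" "[P = 1] (mod int m)"
    "real_of_int P = 2 * of_int c * cos t" "pi / m < t" "t < 2 * pi / m"
proof -
  have m: "0 < real m" "1 < real m" using assms by auto
  have ord: "0 < pi / m" "pi / m < 2 * pi / m" "2 * pi / m \<le> pi"
    using assms by (auto simp: field_simps)
  define lo hi where "lo = cos (2 * pi / m)" and "hi = cos (pi / m)"
  have "lo < hi" unfolding lo_def hi_def using ord by (intro cos_monotone_0_pi) auto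
  then obtain r where r: "1 / (hi - lo) < real m ^ r"
    using real_arch_pow[OF m(2)] by blast
  define T where "T = 2 * real m ^ r"
  have T: "0 < T" using m by (simp add: T_def)
  have "1 < (hi - lo) * real m ^ r" using r \<open>lo < hi\<close> by (simp add: field_simps)
  then have gap: "lo * T + 1 < hi * T" using \<open>lo < hi\<close> by (simp add: T_def algebra_simps)
  \<comment> \<open>the least integer \<open>k\<close> for which \<open>(1 / m + k) / T\<close> exceeds \<open>lo\<close>; the gap keeps it below \<open>hi\<close>\<close>
  define k where "k = \<lfloor>lo * T - 1 / m\<rfloor> + 1"
  have k: "lo * T < 1 / m + k" "1 / m + k \<le> lo * T + 1"
    unfolding k_def by linarith+
  define x where "x = (1 / m + k) / T"
  have x: "lo < x" "x < hi"
    using k gap T by (simp_all add: x_def field_simps)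
  have x1: "-1 \<le> x" "x \<le> 1"
    using x cos_ge_minus_one[of "2 * pi / m"] cos_le_one[of "pi / m"] unfolding lo_def hi_def by linarith+
  have cosx: "cos (arccos x) = x" using x1 by simp
  have "arccos lo = 2 * pi / m" "arccos hi = pi / m"
    unfolding lo_def hi_def using ord by (auto intro!: arccos_cos)
  moreover have "arccos x < arccos lo" "arccos hi < arccos x"
    using x x1 by (auto intro!: arccos_less_arccos simp: lo_def hi_def)
  ultimately have t: "pi / m < arccos x" "arccos x < 2 * pi / m" by simp_all
  have "real_of_int (1 + int m * k) = 2 * of_int (int m ^ Suc r) * cos (arccos x)"
    unfolding cosx using m by (simp add: x_def T_def field_simps)
  moreover have "[1 + int m * k = 1] (mod int m)" by (simp add: cong_def)
  ultimately show ?thesis using t that by blast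
qed

text \<open>A proper divisor of \<open>m\<close> is at most \<open>m / 2\<close>, which keeps \<open>d * t\<close> below \<open>pi\<close>.\<close>

lemma sin_sign_at_multiples:
  assumes t: "pi / m < t" "t < 2 * pi / m" and m: "2 \<le> (m::nat)"
  shows "sin (real m * t) < 0" and "\<And>d. 0 < d \<Longrightarrow> d dvd m \<Longrightarrow> d < m \<Longrightarrow> 0 < sin (real d * t)"
proof -
  have "pi < real m * t" "real m * t < 2 * pi" using t m by (simp_all add: field_simps)
  then show "sin (real m * t) < 0" by (rule sin_lt_zero)
  fix d assume d: "0 < d" "d dvd m" "d < m"
  then obtain k where k: "m = d * k" by (elim dvdE)
  with d have "2 \<le> k" by (cases k) auto
  then have "2 * d \<le> m" using k by simp
  have t0: "0 < t" using t(1) m by (smt (verit) divide_pos_pos of_nat_0_less_iff pi_gt_zero zero_less_numeral order_less_le_trans)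
  have "2 * (real d * t) = real (2 * d) * t" by simp
  also have "\<dots> \<le> real m * t" using \<open>2 * d \<le> m\<close> t0 by (intro mult_right_mono) (simp_all only: of_nat_le_iff)
  also have "\<dots> < 2 * pi" by fact
  finally show "0 < sin (real d * t)" using t0 d by (intro sin_gt_zero) auto
qed

theorem prime_cong_minus_1:
  assumes "0 < (n::nat)"
  shows "\<exists>q. prime q \<and> n dvd q + 1"
proof -
  \<comment> \<open>an even modulus forces the primes below to be odd, and from \<open>3\<close> on \<open>1\<close> and \<open>-1\<close> differ\<close>
  define m where "m = 4 * n"
  have m: "3 \<le> m" "even m" "n dvd m" using assms by (auto simp: m_def)
  obtain P c :: int and r and t :: real where
    c: "c = int m ^ Suc r" and P: "[P = 1] (mod int m)" and cos: "real_of_int P = 2 * of_int c * cos t"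
    and t: "pi / m < t" "t < 2 * pi / m"
    using lucas_parameters[OF m(1)] .
  define U where "U = lucas P (c ^ 2)"
  have c0: "0 < c" using m by (simp add: c)
  have "0 < pi / m" "2 * pi / m \<le> pi" using m by (auto simp: field_simps)
  then have sint: "0 < sin t" using t by (intro sin_gt_zero) auto
  have U1: "[U e = 1] (mod int m)" if "0 < e" for e
    using lucas_cong_1[OF P, of "c ^ 2" "e - 1"] that by (simp add: U_def c power2_eq_square)
  have sine: "sin t * of_int (U e) = of_int c ^ (e - 1) * sin (real e * t)" if "0 < e" for e
    using lucas_sine[OF cos, of "e - 1"] that by (simp add: U_def)
  have sgn: "0 < U e \<longleftrightarrow> 0 < sin (real e * t)" "U e < 0 \<longleftrightarrow> sin (real e * t) < 0" if "0 < e" for e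
  proof -
    have cp: "0 < real_of_int c ^ (e - 1)" using c0 by simp
    have "0 < U e \<longleftrightarrow> 0 < sin t * of_int (U e)" using sint by (simp add: zero_less_mult_iff)
    then show "0 < U e \<longleftrightarrow> 0 < sin (real e * t)"
      unfolding sine[OF that] using cp c0 by (simp add: zero_less_mult_iff)
    have "U e < 0 \<longleftrightarrow> sin t * of_int (U e) < 0" using sint by (simp add: mult_less_0_iff)
    then show "U e < 0 \<longleftrightarrow> sin (real e * t) < 0"
      unfolding sine[OF that] using cp c0 by (simp add: mult_less_0_iff)
  qed
  have Um: "U m < 0" using sgn(2)[of m] sin_sign_at_multiples(1)[OF t] m by simp
  have Ud: "0 < U d" if "d dvd m" "d < m" for d
    using sgn(1)[of d] sin_sign_at_multiples(2)[OF t, of d] m that dvd_pos_nat[of m d] by simp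
  \<comment> \<open>the discriminant is \<open>- (2 * c * sin t)\<^sup>2\<close>\<close>
  have D: "P ^ 2 - 4 * c ^ 2 \<noteq> 0"
  proof -
    have "real_of_int (P ^ 2 - 4 * c ^ 2) = - 4 * of_int c ^ 2 * (sin t) ^ 2"
      using cos by (simp add: sin_squared_eq power_mult_distrib algebra_simps)
    moreover have "- 4 * of_int c ^ 2 * (sin t) ^ 2 \<noteq> 0" using sint c0 by simp
    ultimately show ?thesis by (metis of_int_0)
  qed
  \<comment> \<open>because \<open>U m \<equiv> 1\<close>, and because \<open>c\<close> is a power of \<open>m\<close>\<close>
  have good: "\<not> q dvd m \<and> \<not> int q dvd c ^ 2" if q: "prime q" "int q dvd U m" for q
  proof -
    have "\<not> q dvd m"
    proof
      assume "q dvd m"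
      then have "[U m = 1] (mod int q)"
        using U1[of m] m cong_dvd_modulus[of "U m" 1 "int m" "int q"] by simp
      then have "int q dvd 1" using q(2) cong_dvd_iff by blast
      then show False using q(1) by (auto dest: not_prime_unit)
    qed
    moreover have "q dvd m" if "int q dvd c ^ 2"
    proof -
      have "prime (int q)" using q(1) by simp
      then have "int q dvd int m" using that unfolding c by (metis prime_dvd_power)
      then show ?thesis by simp
    qed
    ultimately show ?thesis by blast
  qed
  define S where "S = prime_factors (nat \<bar>U m\<bar>)"
  define \<rho> where "\<rho> q = lucas_rank P (c ^ 2) (int q)" for q
  define v where "v q = multiplicity q (nat \<bar>U m\<bar>)" for q
  have fac: "nat \<bar>U e\<bar> = (\<Prod>q | q \<in> S \<and> \<rho> q dvd e. q ^ v q)" if "e dvd m" for e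
    using lucas_eq_prod_by_rank[of m P "c ^ 2" e] that good m Um
    by (simp add: U_def S_def \<rho>_def v_def)
  have "\<exists>q\<in>S. \<rho> q = m \<and> \<not> [q ^ v q = 1] (mod m)"
  proof (rule factor_of_top_rank)
    show "finite S" by (simp add: S_def)
    show "0 < m" using m by simp
    show "[(\<Prod>q | q \<in> S \<and> \<rho> q dvd d. q ^ v q) = 1] (mod m)" if d: "d dvd m" "d < m" for d
    proof -
      have "0 < d" using d m by (cases d) auto
      then have "[int (nat \<bar>U d\<bar>) = int 1] (mod int m)" using U1[of d] Ud[OF d] by simp
      then show ?thesis unfolding cong_int_iff fac[OF d(1)] .
    qed
    show "\<not> [(\<Prod>q | q \<in> S \<and> \<rho> q dvd m. q ^ v q) = 1] (mod m)"
    proof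
      assume "[(\<Prod>q | q \<in> S \<and> \<rho> q dvd m. q ^ v q) = 1] (mod m)"
      then have "[int (nat \<bar>U m\<bar>) = int 1] (mod int m)"
        unfolding cong_int_iff fac[OF dvd_refl] .
      then have "[- U m + U m = 1 + 1] (mod int m)"
        using Um U1[of m] m by (intro cong_add) auto
      then have "[2 = (0::int)] (mod int m)" by (simp add: cong_sym_eq)
      then have "int m dvd 2" by (simp add: cong_0_iff)
      then show False using m(1) zdvd_imp_le by fastforce
    qed
  qed
  then obtain q where q: "q \<in> S" "\<rho> q = m" "\<not> [q ^ v q = 1] (mod m)" by blast
  have q': "prime q" "int q dvd U m"
    using q(1) by (auto simp: S_def prime_factors_dvd dvd_nat_abs_iff)
  have "odd q"
    using good[OF q'] q'(1) m(2) primes_dvd_imp_eq two_is_prime_nat by metis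
  then have "m = q \<or> m dvd q - 1 \<or> m dvd q + 1"
    using lucas_rank_divides[of q "c ^ 2" m P] q' q(2) good[OF q'] m D
    by (simp add: U_def \<rho>_def)
  moreover have "m \<noteq> q" using good[OF q'] by auto
  moreover have "\<not> m dvd q - 1"
  proof
    assume "m dvd q - 1"
    then have "[q = 1] (mod m)"
      using prime_gt_0_nat[OF q'(1)] by (simp add: cong_altdef_nat)
    then show False using q(3) cong_pow[of q 1 m "v q"] by simp
  qed
  ultimately show ?thesis using q'(1) m(3) dvd_trans by blast
qed

text \<open>A multiple \<open>q + 1\<close> of \<open>x + 2\<close> is at least \<open>x + 2\<close>, so the congruence takes care of the size as well.\<close>

corollary large_prime_fact_dvd_Suc:
  "\<exists>q::nat. prime q \<and> x < q \<and> fact n dvd q + 1"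
proof -
  obtain q :: nat where q: "prime q" "fact n * (x + 2) dvd q + 1"
    using prime_cong_minus_1[of "fact n * (x + 2)"] by auto
  then have "x + 2 dvd q + 1" by (meson dvd_mult_right)
  then have "x < q" using dvd_imp_le[of "x + 2" "q + 1"] by simp
  moreover have "fact n dvd q + 1" using q(2) by (meson dvd_mult_left)
  ultimately show ?thesis using q(1) by blast
qed

section \<open>Ultrafilters\<close>

text \<open>The library order makes a finer filter smaller, so an ultrafilter is a minimal proper filter, found by
  Zorn's lemma. If neither \<open>P\<close> nor its negation held eventually, adjoining \<open>P\<close> would give
  a smaller one.\<close>

lemma exists_ultrafilter_le:
  fixes F :: "'a filter"
  assumes "F \<noteq> bot"
  obtains G where "G \<le> F" "G \<noteq> bot" "\<And>P. eventually P G \<or> eventually (\<lambda>x. \<not> P x) G"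
proof -
  define A where "A = {G. G \<le> F \<and> G \<noteq> bot}"
  have "\<exists>m\<in>A. \<forall>a\<in>A. m \<ge> a \<longrightarrow> a = m"
  proof (rule predicate_Zorn)
    show "partial_order_on A (relation_of (\<ge>) A)"
      by (rule partial_order_on_relation_ofI) auto
    fix C assume C: "C \<in> Chains (relation_of (\<ge>) A)"
    then have CA: "C \<subseteq> A" and tot: "\<And>a b. a \<in> C \<Longrightarrow> b \<in> C \<Longrightarrow> a \<le> b \<or> b \<le> a"
      by (auto simp: Chains_def relation_of_def)
    show "\<exists>u\<in>A. \<forall>a\<in>C. a \<ge> u"
    proof (cases "C = {}")
      case True
      then show ?thesis using assms by (auto simp: A_def)
    next
      case False
      have "eventually (\<lambda>_. False) (Inf C) \<longleftrightarrow> (\<exists>b\<in>C. eventually (\<lambda>_. False) b)"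
        using False by (rule eventually_Inf_base) (metis tot inf.absorb1 inf.absorb2 order_refl)
      then have "Inf C \<noteq> bot"
        using CA by (auto simp: A_def simp flip: trivial_limit_def)
      moreover obtain c where "c \<in> C" using False by blast
      then have "Inf C \<le> F" using CA by (intro order_trans[OF Inf_lower]) (auto simp: A_def)
      ultimately show ?thesis by (intro bexI[of _ "Inf C"]) (auto simp: A_def Inf_lower)
    qed
  qed
  then obtain G where G: "G \<le> F" "G \<noteq> bot" and min: "\<And>H. H \<le> G \<Longrightarrow> H \<noteq> bot \<Longrightarrow> H = G"
    by (auto simp: A_def intro: order_trans)
  have "eventually P G \<or> eventually (\<lambda>x. \<not> P x) G" for P
  proof (cases "inf G (principal {x. P x}) = bot")
    case True
    then have "eventually (\<lambda>_. False) (inf G (principal {x. P x}))" by simp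
    then show ?thesis by (simp add: eventually_inf_principal)
  next
    case False
    then have "inf G (principal {x. P x}) = G" by (intro min) simp
    then have "G \<le> principal {x. P x}" by (metis inf.cobounded2)
    then show ?thesis by (simp add: le_principal)
  qed
  with G show ?thesis using that by blast
qed

section \<open>Satisfaction and the standard model\<close>

lemma tm_val_cong: "(\<And>n. n \<in> tm_vars t \<Longrightarrow> e n = e' n) \<Longrightarrow> tm_val M e t = tm_val M e' t"
  by (induction t) auto

lemma sat_cong: "(\<And>n. n \<in> free_vars \<phi> \<Longrightarrow> e n = e' n) \<Longrightarrow> sat M e \<phi> = sat M e' \<phi>"
proof (induction \<phi> arbitrary: e e')
  case (Eq s t)
  then show ?case using tm_val_cong[of s e e' M] tm_val_cong[of t e e' M] by auto
next
  case (Imp \<phi> \<psi>)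
  then show ?case by (metis UnCI free_vars.simps(3) sat.simps(3))
next
  case (All \<phi>)
  have "sat M (case_nat x e) \<phi> = sat M (case_nat x e') \<phi>" for x
    using All.prems by (intro All.IH) (auto split: nat.split)
  then show ?case by simp
qed simp

lemma tm_val_tsubst: "tm_val M e (tsubst \<sigma> t) = tm_val M (\<lambda>n. tm_val M e (\<sigma> n)) t"
  by (induction t) auto

lemma sat_subst: "sat M e (subst \<sigma> \<phi>) = sat M (\<lambda>n. tm_val M e (\<sigma> n)) \<phi>"
proof (induction \<phi> arbitrary: e \<sigma>)
  case (All \<phi>)
  have "(\<lambda>n. tm_val M (case_nat x e) (case_nat (Var 0) (\<lambda>n. tsubst (\<lambda>k. Var (Suc k)) (\<sigma> n)) n))
      = case_nat x (\<lambda>n. tm_val M e (\<sigma> n))" for x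
    by (rule ext) (simp add: tm_val_tsubst split: nat.split)
  then show ?case by (simp add: All.IH)
qed (simp_all add: tm_val_tsubst)

lemma sat_inst: "sat M e (inst \<phi> t) = sat M (case_nat (tm_val M e t) e) \<phi>"
  unfolding inst_def sat_subst by (rule arg_cong[where f = "\<lambda>e. sat M e \<phi>"]) (auto split: nat.split)

lemma finite_tm_vars: "finite (tm_vars t)"
  by (induction t) auto

lemma finite_free_vars: "finite (free_vars \<phi>)"
proof (induction \<phi>)
  case (All \<phi>)
  then show ?case using finite_vimageI[of "free_vars \<phi>" Suc] by (simp add: vimage_def)
qed (simp_all add: finite_tm_vars)

definition std :: "nat arith" where
  "std = \<lparr>univ = UNIV, zero_of = 0, succ_of = Suc, add_of = (+), mul_of = (*)\<rparr>"

lemma std_simps [simp]: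
  "univ std = UNIV" "zero_of std = 0" "succ_of std = Suc" "add_of std = (+)" "mul_of std = (*)"
  by (simp_all add: std_def)

lemma sat_std_All_funpow: "(\<And>e. sat std e \<phi>) \<Longrightarrow> sat std e ((All ^^ n) \<phi>)"
  by (induction n arbitrary: e) auto

text \<open>For the closed induction formulas it matters that \<open>sat\<close> in the standard model ranges over all
  environments: stripping the quantifiers of the closure leaves the plain induction formula in an
  arbitrary environment, which is induction on the natural numbers.\<close>

lemma sat_std_PA:
  assumes "\<phi> \<in> PA"
  shows "sat std e \<phi>"
  using assms
proof cases
  case (induction n \<psi>)
  have "sat std e (induction_fm \<psi>)" for e
  proof -
    have s: "(\<lambda>n. tm_val std (case_nat x e) (case_nat (Succ (Var 0)) (\<lambda>n. Var (Suc n)) n)) = case_nat (Suc x) e" for x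
      by (rule ext) (simp split: nat.split)
    have ind: "sat std (case_nat x e) \<psi>" if "sat std (case_nat 0 e) \<psi>"
      "\<And>x. sat std (case_nat x e) \<psi> \<Longrightarrow> sat std (case_nat (Suc x) e) \<psi>" for x
      using that by (induction x) auto
    show ?thesis
      unfolding induction_fm_def sat.simps sat_inst sat_subst s tm_val.simps std_simps
      using ind by blast
  qed
  then show ?thesis unfolding induction(1) by (rule sat_std_All_funpow)
qed (auto simp: algebra_simps)

section \<open>A countable ultrapower\<close>

instance tm :: countable by countable_datatype
instance fm :: countable by countable_datatype

text \<open>Skolem terms over the generators \<open>Gen i\<close>. \<open>Wit \<phi> ts\<close> denotes an element satisfying \<open>\<phi>\<close> in
  variable 0, the further variables of \<open>\<phi>\<close> being the values of \<open>ts\<close>. The arithmetical operations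
  are constructors so that the values are closed under them by definition.\<close>

datatype sterm = Gen nat | SZero | SSucc sterm | SAdd sterm sterm | SMul sterm sterm | Wit fm "sterm list"

instance sterm :: countable by countable_datatype

text \<open>The value of a Skolem term in the \<open>n\<close>-th factor of the ultrapower, where \<open>Gen i\<close> denotes an arbitrary
  sequence \<open>g i\<close>. The padding gives variables beyond the end of \<open>ts\<close> the value 0.\<close>

fun sterm_val :: "(nat \<Rightarrow> nat \<Rightarrow> nat) \<Rightarrow> nat \<Rightarrow> sterm \<Rightarrow> nat" where
  "sterm_val g n (Gen i) = g i n"
| "sterm_val g n SZero = 0"
| "sterm_val g n (SSucc s) = Suc (sterm_val g n s)"
| "sterm_val g n (SAdd s t) = sterm_val g n s + sterm_val g n t"
| "sterm_val g n (SMul s t) = sterm_val g n s * sterm_val g n t"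
| "sterm_val g n (Wit \<phi> ts) =
     (SOME x. sat std (case_nat x (\<lambda>i. (map (sterm_val g n) ts @ replicate (Suc i) 0) ! i)) \<phi>)"

text \<open>A class modulo \<open>F\<close> is represented by the code of a chosen member, so that the universe of the ultrapower
  consists of natural numbers.\<close>

definition sterm_class :: "nat filter \<Rightarrow> (nat \<Rightarrow> nat \<Rightarrow> nat) \<Rightarrow> sterm \<Rightarrow> nat" where
  "sterm_class F g s = to_nat (SOME t. \<forall>\<^sub>F n in F. sterm_val g n t = sterm_val g n s)"

definition skolem_ultrapower :: "nat filter \<Rightarrow> (nat \<Rightarrow> nat \<Rightarrow> nat) \<Rightarrow> nat arith" where
  "skolem_ultrapower F g =
    \<lparr>univ = range (sterm_class F g), zero_of = sterm_class F g SZero,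
     succ_of = (\<lambda>x. sterm_class F g (SSucc (from_nat x))),
     add_of = (\<lambda>x y. sterm_class F g (SAdd (from_nat x) (from_nat y))),
     mul_of = (\<lambda>x y. sterm_class F g (SMul (from_nat x) (from_nat y)))\<rparr>"

lemma sterm_class_rep: "\<forall>\<^sub>F n in F. sterm_val g n (from_nat (sterm_class F g s)) = sterm_val g n s"
  unfolding sterm_class_def from_nat_to_nat
  by (rule someI[of "\<lambda>t. \<forall>\<^sub>F n in F. sterm_val g n t = sterm_val g n s" s]) simp

lemma sterm_class_eq_iff:
  "sterm_class F g s = sterm_class F g t \<longleftrightarrow> (\<forall>\<^sub>F n in F. sterm_val g n s = sterm_val g n t)"
proof
  assume "sterm_class F g s = sterm_class F g t"
  then have "\<forall>\<^sub>F n in F. sterm_val g n (from_nat (sterm_class F g s)) = sterm_val g n t"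
    using sterm_class_rep[of g F t] by simp
  then show "\<forall>\<^sub>F n in F. sterm_val g n s = sterm_val g n t"
    using sterm_class_rep[of g F s] by eventually_elim simp
next
  assume st: "\<forall>\<^sub>F n in F. sterm_val g n s = sterm_val g n t"
  have "(\<forall>\<^sub>F n in F. sterm_val g n u = sterm_val g n s) \<longleftrightarrow> (\<forall>\<^sub>F n in F. sterm_val g n u = sterm_val g n t)" for u
    using st by (auto elim: eventually_elim2)
  then show "sterm_class F g s = sterm_class F g t" by (simp add: sterm_class_def)
qed

lemma skolem_ultrapower_simps:
  "univ (skolem_ultrapower F g) = range (sterm_class F g)"
  "zero_of (skolem_ultrapower F g) = sterm_class F g SZero"
  "succ_of (skolem_ultrapower F g) (sterm_class F g s) = sterm_class F g (SSucc s)"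
  "add_of (skolem_ultrapower F g) (sterm_class F g s) (sterm_class F g t) = sterm_class F g (SAdd s t)"
  "mul_of (skolem_ultrapower F g) (sterm_class F g s) (sterm_class F g t) = sterm_class F g (SMul s t)"
  using sterm_class_rep[of g F s] sterm_class_rep[of g F t]
  by (auto simp: skolem_ultrapower_def sterm_class_eq_iff elim: eventually_elim2)

text \<open>A term evaluated at classes is the class of one Skolem term, which is thus a representative for
  all coordinates \<open>n\<close> at once.\<close>

lemma tm_val_skolem_ultrapower:
  "\<exists>s. tm_val (skolem_ultrapower F g) (\<lambda>i. sterm_class F g (T i)) t = sterm_class F g s \<and>
     (\<forall>n. sterm_val g n s = tm_val std (\<lambda>i. sterm_val g n (T i)) t)"
proof (induction t)
  case (Succ t)
  then obtain s where "tm_val (skolem_ultrapower F g) (\<lambda>i. sterm_class F g (T i)) t = sterm_class F g s"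
     "\<forall>n. sterm_val g n s = tm_val std (\<lambda>i. sterm_val g n (T i)) t" by blast
  then show ?case by (intro exI[of _ "SSucc s"]) (simp add: skolem_ultrapower_simps)
next
  case (Add t t')
  then obtain s s' where "tm_val (skolem_ultrapower F g) (\<lambda>i. sterm_class F g (T i)) t = sterm_class F g s"
     "\<forall>n. sterm_val g n s = tm_val std (\<lambda>i. sterm_val g n (T i)) t"
     "tm_val (skolem_ultrapower F g) (\<lambda>i. sterm_class F g (T i)) t' = sterm_class F g s'"
     "\<forall>n. sterm_val g n s' = tm_val std (\<lambda>i. sterm_val g n (T i)) t'" by blast
  then show ?case by (intro exI[of _ "SAdd s s'"]) (simp add: skolem_ultrapower_simps)
next
  case (Mul t t')
  then obtain s s' where "tm_val (skolem_ultrapower F g) (\<lambda>i. sterm_class F g (T i)) t = sterm_class F g s"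
     "\<forall>n. sterm_val g n s = tm_val std (\<lambda>i. sterm_val g n (T i)) t"
     "tm_val (skolem_ultrapower F g) (\<lambda>i. sterm_class F g (T i)) t' = sterm_class F g s'"
     "\<forall>n. sterm_val g n s' = tm_val std (\<lambda>i. sterm_val g n (T i)) t'" by blast
  then show ?case by (intro exI[of _ "SMul s s'"]) (simp add: skolem_ultrapower_simps)
next
  case Zero
  show ?case by (intro exI[of _ SZero]) (simp add: skolem_ultrapower_simps)
qed auto

text \<open>The quantifier is where the restriction to Skolem terms matters: if \<open>\<forall>x. \<phi>\<close> failed for most \<open>n\<close>, the
  term \<open>Wit (Neg \<phi>) ts\<close>, with enough parameters \<open>ts\<close> to cover the free variables of \<open>\<phi>\<close>, would be a
  counterexample in the ultrapower.\<close>

theorem los: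
  assumes F: "F \<noteq> bot" "\<And>P. eventually P F \<or> eventually (\<lambda>x. \<not> P x) F"
  shows "sat (skolem_ultrapower F g) (\<lambda>i. sterm_class F g (T i)) \<phi> \<longleftrightarrow>
    (\<forall>\<^sub>F n in F. sat std (\<lambda>i. sterm_val g n (T i)) \<phi>)"
proof (induction \<phi> arbitrary: T)
  case (Eq s t)
  obtain s' t' where "tm_val (skolem_ultrapower F g) (\<lambda>i. sterm_class F g (T i)) s = sterm_class F g s'"
     "\<forall>n. sterm_val g n s' = tm_val std (\<lambda>i. sterm_val g n (T i)) s"
     "tm_val (skolem_ultrapower F g) (\<lambda>i. sterm_class F g (T i)) t = sterm_class F g t'"
     "\<forall>n. sterm_val g n t' = tm_val std (\<lambda>i. sterm_val g n (T i)) t"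
    using tm_val_skolem_ultrapower by metis
  then show ?case by (simp add: sterm_class_eq_iff)
next
  case Falsum
  then show ?case using F(1) by (simp add: trivial_limit_def)
next
  case (Imp \<phi> \<psi>)
  have not: "eventually (\<lambda>x. \<not> P x) F" if "\<not> eventually P F" for P using F(2)[of P] that by blast
  have "(\<forall>\<^sub>F n in F. sat std (\<lambda>i. sterm_val g n (T i)) \<psi>)"
    if "\<forall>\<^sub>F n in F. sat std (\<lambda>i. sterm_val g n (T i)) (Imp \<phi> \<psi>)" "\<forall>\<^sub>F n in F. sat std (\<lambda>i. sterm_val g n (T i)) \<phi>"
    using that by eventually_elim simp
  moreover have "\<forall>\<^sub>F n in F. sat std (\<lambda>i. sterm_val g n (T i)) (Imp \<phi> \<psi>)"
    if "\<forall>\<^sub>F n in F. sat std (\<lambda>i. sterm_val g n (T i)) \<psi>"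
    using that by eventually_elim simp
  moreover have "\<forall>\<^sub>F n in F. sat std (\<lambda>i. sterm_val g n (T i)) (Imp \<phi> \<psi>)"
    if "\<not> (\<forall>\<^sub>F n in F. sat std (\<lambda>i. sterm_val g n (T i)) \<phi>)"
    using not[OF that] by eventually_elim simp
  ultimately show ?case unfolding sat.simps(3)[of "skolem_ultrapower F g"] Imp by blast
next
  case (All \<phi>)
  have push: "case_nat (sterm_class F g s) (\<lambda>i. sterm_class F g (T i)) = (\<lambda>i. sterm_class F g (case_nat s T i))"
    "case_nat (sterm_val g n s) (\<lambda>i. sterm_val g n (T i)) = (\<lambda>i. sterm_val g n (case_nat s T i))" for s n
    by (rule ext; simp split: nat.split)+
  have "sat (skolem_ultrapower F g) (\<lambda>i. sterm_class F g (T i)) (All \<phi>) \<longleftrightarrow>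
      (\<forall>s. \<forall>\<^sub>F n in F. sat std (case_nat (sterm_val g n s) (\<lambda>i. sterm_val g n (T i))) \<phi>)"
    by (simp add: skolem_ultrapower_simps push All.IH)
  also have "\<dots> \<longleftrightarrow> (\<forall>\<^sub>F n in F. \<forall>x. sat std (case_nat x (\<lambda>i. sterm_val g n (T i))) \<phi>)"
  proof
    assume all: "\<forall>s. \<forall>\<^sub>F n in F. sat std (case_nat (sterm_val g n s) (\<lambda>i. sterm_val g n (T i))) \<phi>"
    obtain k where k: "free_vars \<phi> \<subseteq> {..k}" by (meson finite_free_vars finite_nat_iff_bounded_le)
    \<comment> \<open>variable 0 of \<open>\<phi>\<close> is the quantified one, so the parameters are the variables 1 to \<open>k\<close>\<close>
    define w where "w = Wit (Neg \<phi>) (map T [0..<k])"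
    have agree: "sat std (case_nat x (\<lambda>i. (map (sterm_val g n) (map T [0..<k]) @ replicate (Suc i) 0) ! i)) \<phi>
        \<longleftrightarrow> sat std (case_nat x (\<lambda>i. sterm_val g n (T i))) \<phi>" for x n
      using k by (intro sat_cong) (auto simp: nth_append split: nat.split)
    have "\<forall>\<^sub>F n in F. sat std (case_nat (sterm_val g n w) (\<lambda>i. sterm_val g n (T i))) \<phi>"
      using all by blast
    then show "\<forall>\<^sub>F n in F. \<forall>x. sat std (case_nat x (\<lambda>i. sterm_val g n (T i))) \<phi>"
    proof eventually_elim
      case (elim n)
      show ?case
      proof (rule ccontr)
        assume "\<not> ?case"
        then obtain x where "\<not> sat std (case_nat x (\<lambda>i. sterm_val g n (T i))) \<phi>" by blast
        then have "\<not> sat std (case_nat (SOME x. \<not> sat std (case_nat x (\<lambda>i. sterm_val g n (T i))) \<phi>) (\<lambda>i. sterm_val g n (T i))) \<phi>"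
          by (rule someI)
        then show False using elim by (simp only: w_def sterm_val.simps sat.simps agree simp_thms)
      qed
    qed
  qed (auto elim: eventually_mono)
  finally show ?case by simp
qed

lemma is_model_skolem_ultrapower:
  assumes F: "F \<noteq> bot" "\<And>P. eventually P F \<or> eventually (\<lambda>x. \<not> P x) F"
  shows "is_model (skolem_ultrapower F g) PA"
  unfolding is_model_def
proof (intro conjI ballI allI impI)
  show "is_structure (skolem_ultrapower F g)"
    by (auto simp: is_structure_def skolem_ultrapower_simps)
  fix \<phi> and e :: "nat \<Rightarrow> nat" assume \<phi>: "\<phi> \<in> PA" and "range e \<subseteq> univ (skolem_ultrapower F g)"
  then have "\<forall>i. \<exists>s. e i = sterm_class F g s" by (auto simp: skolem_ultrapower_simps)
  then obtain T where "\<forall>i. e i = sterm_class F g (T i)" by metis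
  then have "e = (\<lambda>i. sterm_class F g (T i))" by auto
  then show "sat (skolem_ultrapower F g) e \<phi>"
    by (simp add: los[OF F] sat_std_PA[OF \<phi>])
qed

text \<open>Standard elements are the classes of constant sequences.\<close>

lemma standard_part_skolem_ultrapower:
  "x \<in> standard_part (skolem_ultrapower F g) \<longleftrightarrow>
    (\<exists>k s. x = sterm_class F g s \<and> (\<forall>n. sterm_val g n s = k))"
proof -
  have num: "(succ_of (skolem_ultrapower F g) ^^ k) (zero_of (skolem_ultrapower F g))
      = sterm_class F g ((SSucc ^^ k) SZero)" for k
    by (induction k) (simp_all add: skolem_ultrapower_simps)
  have val: "sterm_val g n ((SSucc ^^ k) SZero) = k" for n k
    by (induction k) simp_all
  have "sterm_class F g s = sterm_class F g ((SSucc ^^ k) SZero)" if "\<forall>n. sterm_val g n s = k" for s k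
    using that by (simp add: sterm_class_eq_iff val)
  then show ?thesis unfolding standard_part_def num using val by blast
qed

section \<open>Transfer of arithmetical notions\<close>

text \<open>The notions of the theorem as formulas, with their arguments in the variables 0 and 1; inside a
  quantifier the indices are shifted accordingly.\<close>

definition le_fm :: fm where
  "le_fm = Neg (All (Neg (Eq (Add (Var 1) (Var 0)) (Var 2))))"

definition divisor_fm :: fm where
  "divisor_fm = Neg (All (Neg (Eq (Var 2) (Mul (Var 0) (Var 1)))))"

definition prime_fm :: fm where
  "prime_fm = Neg (Imp (Neg (All (Neg (Eq (Add (Succ (Succ Zero)) (Var 0)) (Var 1)))))
     (Neg (All (All (Imp (Eq (Mul (Var 1) (Var 0)) (Var 2))
        (Imp (Neg (Eq (Var 1) (Var 2))) (Eq (Var 0) (Var 2))))))))"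

lemma sat_le_fm: "sat M e le_fm \<longleftrightarrow> le_in M (e 0) (e 1)"
  by (simp add: le_fm_def le_in_def numeral_2_eq_2)

lemma sat_divisor_fm: "sat M e divisor_fm \<longleftrightarrow> divisor_in M (e 0) (e 1)"
  by (simp add: divisor_fm_def divisor_in_def numeral_2_eq_2)

lemma sat_prime_fm: "e 0 \<in> univ M \<Longrightarrow> sat M e prime_fm \<longleftrightarrow> prime_in M (e 0)"
  by (auto simp: prime_fm_def prime_in_def le_in_def two_of_def numeral_2_eq_2)

context
  fixes F :: "nat filter"
  assumes F: "F \<noteq> bot" "\<And>P. eventually P F \<or> eventually (\<lambda>x. \<not> P x) F"
begin

lemma le_in_skolem_ultrapower:
  "le_in (skolem_ultrapower F g) (sterm_class F g s) (sterm_class F g t) \<longleftrightarrow>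
    (\<forall>\<^sub>F n in F. sterm_val g n s \<le> sterm_val g n t)"
  using los[OF F, of g "case_nat s (\<lambda>_. t)" le_fm]
  by (simp add: sat_le_fm le_in_def[of std] le_iff_add eq_commute)

lemma divisor_in_skolem_ultrapower:
  "divisor_in (skolem_ultrapower F g) (sterm_class F g s) (sterm_class F g t) \<longleftrightarrow>
    (\<forall>\<^sub>F n in F. sterm_val g n s dvd sterm_val g n t)"
  using los[OF F, of g "case_nat s (\<lambda>_. t)" divisor_fm]
  by (simp add: sat_divisor_fm divisor_in_def[of std] dvd_def mult.commute)

lemma prime_in_skolem_ultrapower:
  "prime_in (skolem_ultrapower F g) (sterm_class F g s) \<longleftrightarrow>
    (\<forall>\<^sub>F n in F. prime_in std (sterm_val g n s))"
  using los[OF F, of g "\<lambda>_. s" prime_fm]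
  by (simp add: sat_prime_fm skolem_ultrapower_simps)

end

lemma prime_in_std: "prime_in std q \<longleftrightarrow> prime q"
proof
  assume "prime_in std q"
  then have "2 \<le> q" and *: "\<And>x y. x * y = q \<Longrightarrow> x = q \<or> y = q"
    by (auto simp: prime_in_def le_in_def two_of_def)
  have "d = 1 \<or> d = q" if d: "d dvd q" for d
  proof -
    obtain y where y: "q = d * y" using d by (elim dvdE)
    then have "d = q \<or> y = q" using *[of d y] by simp
    then show ?thesis using y \<open>2 \<le> q\<close> by auto
  qed
  then show "prime q" using \<open>2 \<le> q\<close> by (simp add: prime_nat_iff)
next
  assume q: "prime q"
  have "x = q \<or> y = q" if "x * y = q" for x y
    using q that prime_product[of x y] by auto
  moreover have "\<exists>z. 2 + z = q" using prime_ge_2_nat[OF q] by (metis le_iff_add)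
  ultimately show "prime_in std q"
    by (simp add: prime_in_def le_in_def two_of_def)
qed

section \<open>The model\<close>

theorem theorem1p1:
  assumes "consistent PA"
  shows "\<exists>(M :: nat arith) (q :: nat \<Rightarrow> nat).
    is_model M PA \<and> countable (univ M) \<and>
    (\<forall>i\<ge>1. infinite_prime M (q i)) \<and>
    (\<forall>i\<ge>1. less_in M (q i) (q (i + 1))) \<and>
    (\<forall>i\<ge>1. \<not> (\<exists>p. finite_prime M p \<and> divisor_in M p (add_of M (q i) (two_of M))))"
proof -
  have "\<forall>n x. \<exists>p::nat. prime p \<and> x < p \<and> fact n dvd p + 1"
    using large_prime_fact_dvd_Suc by blast
  then obtain h :: "nat \<Rightarrow> nat \<Rightarrow> nat"
    where h: "\<And>n x. prime (h n x) \<and> x < h n x \<and> fact n dvd h n x + 1"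
    by metis
  \<comment> \<open>all members of the \<open>n\<close>-th column \<open>g 0 n < g 1 n < \<dots>\<close> are \<open>\<equiv> -1\<close> modulo \<open>n!\<close>\<close>
  define g :: "nat \<Rightarrow> nat \<Rightarrow> nat" where "g i n = (h n ^^ Suc i) n" for i n
  have prime_g: "prime (g i n)" and fact_g: "fact n dvd g i n + 1" and less_g: "g i n < g (Suc i) n" for i n
    using h[of n "(h n ^^ i) n"] h[of n "(h n ^^ Suc i) n"] by (simp_all add: g_def)
  have gt_g: "n < g i n" for i n
  proof (induction i)
    case 0
    show ?case using h[of n n] by (simp add: g_def)
  next
    case (Suc i)
    then show ?case using less_g[of i n] by simp
  qed
  have not_dvd_g: "\<not> k dvd g i n + 2" if "2 \<le> k" "k \<le> n" for k i n
  proof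
    assume "k dvd g i n + 2"
    moreover have "k dvd g i n + 1" using that fact_g[of n i] dvd_fact[of k n] dvd_trans by fastforce
    ultimately have "k dvd (g i n + 2) - (g i n + 1)" by (rule dvd_diff_nat)
    then show False using that by simp
  qed
  obtain F :: "nat filter" where F: "F \<noteq> bot" "\<And>P. eventually P F \<or> eventually (\<lambda>x. \<not> P x) F"
    and le: "F \<le> sequentially"
    using exists_ultrafilter_le[of sequentially] by auto
  \<comment> \<open>the ultrafilter is nonprincipal\<close>
  have large: "eventually (\<lambda>n. k \<le> n) F" for k
    using le eventually_ge_at_top filter_leD by blast
  define M where "M = skolem_ultrapower F g"
  define q where "q i = sterm_class F g (Gen i)" for i
  have nonstd: "q i \<notin> standard_part M" for i
  proof
    assume "q i \<in> standard_part M"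
    then obtain k s where "q i = sterm_class F g s" "\<forall>n. sterm_val g n s = k"
      by (auto simp: M_def standard_part_skolem_ultrapower)
    then have "\<forall>\<^sub>F n in F. g i n = k" by (simp add: q_def sterm_class_eq_iff)
    with large[of k] have "\<forall>\<^sub>F n in F. False"
      by eventually_elim (use gt_g in \<open>auto simp: not_less[symmetric]\<close>)
    then show False using F(1) by (simp add: trivial_limit_def)
  qed
  have "prime_in M (q i)" for i
    unfolding M_def q_def prime_in_skolem_ultrapower[OF F] by (simp add: prime_in_std prime_g)
  then have inf: "infinite_prime M (q i)" for i using nonstd by (simp add: infinite_prime_def)
  have less: "less_in M (q i) (q (i + 1))" for i
    using less_g[of i] F(1)
    by (simp add: less_in_def M_def q_def le_in_skolem_ultrapower[OF F] sterm_class_eq_iff less_imp_le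
        less_imp_neq trivial_limit_def[symmetric])
  have nodiv: False if p: "finite_prime M p" "divisor_in M p (add_of M (q i) (two_of M))" for p i
  proof -
    obtain k s where ks: "p = sterm_class F g s" "\<forall>n. sterm_val g n s = k"
      using p(1) by (auto simp: finite_prime_def M_def standard_part_skolem_ultrapower)
    have "prime k"
      using p(1) F(1) by (simp add: finite_prime_def M_def ks prime_in_skolem_ultrapower[OF F] prime_in_std)
    have "add_of M (q i) (two_of M) = sterm_class F g (SAdd (Gen i) (SSucc (SSucc SZero)))"
      by (simp add: M_def q_def two_of_def skolem_ultrapower_simps)
    then have "\<forall>\<^sub>F n in F. k dvd g i n + 2"
      using p(2) ks by (simp add: M_def divisor_in_skolem_ultrapower[OF F])
    with large[of k] have "\<forall>\<^sub>F n in F. False"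
      by eventually_elim (use not_dvd_g prime_ge_2_nat[OF \<open>prime k\<close>] in blast)
    then show False using F(1) by (simp add: trivial_limit_def)
  qed
  have "is_model M PA" unfolding M_def by (rule is_model_skolem_ultrapower[OF F])
  moreover have "countable (univ M)" by simp
  ultimately show ?thesis using inf less nodiv by blast
qed

end
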